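(* Let $X$ be a finite set. Two operations $\ast,\star\in\mathcal{M}(X)$ are $\mathcal{R}$-equivalent if and only if $\pi_\ast=\pi_\star$.
   Context: $\mathcal{M}(X)=X^{X\times X}$ is the set of all binary operations on $X$, a monoid under $\triangleright$ defined by $a(\circ\triangleright\ast)b=(a\circ b)\ast(b\circ a)$ for all $a,b\in X$, with identity $a\circ_{lz}b=a$. The right Green's relation $\mathcal{R}$: $\ast\,\mathcal{R}\,\star$ iff $\ast\mathcal{M}(X)=\star\mathcal{M}(X)$, where $\ast\mathcal{M}(X)=\{\ast\triangleright\circ:\circ\in\mathcal{M}(X)\}$. For $\ast\in\mathcal{M}(X)$ let $T_\ast(a,b)=(a\ast b,b\ast a)$, and let $\pi_\ast$ be the equivalence relation on $X\times X$ defined by $(a,b)\,\pi_\ast\,(u,v)\iff T_\ast(a,b)=T_\ast(u,v)$. *)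

theory Defs
  imports "HOL-Algebra.Coset"
begin

text \<open>
  A binary operation on \<open>X\<close> is an extensional function \<open>X \<times> X \<rightarrow>\<^sub>E X\<close>, so that equality of
  operations is equality of their restrictions to \<open>X \<times> X\<close>; the value \<open>f (a, b)\<close> is the product of
  \<open>a\<close> and \<open>b\<close> under \<open>f\<close>.
\<close>

definition binop_monoid :: "'a set \<Rightarrow> ('a \<times> 'a \<Rightarrow> 'a) monoid" where
  "binop_monoid X =
    \<lparr>carrier = X \<times> X \<rightarrow>\<^sub>E X,
     mult = (\<lambda>f g. \<lambda>(a, b) \<in> X \<times> X. g (f (a, b), f (b, a))),
     one = (\<lambda>(a, b) \<in> X \<times> X. a)\<rparr>"

text \<open>In the following, \<open>f <#\<^bsub>G\<^esub> carrier G\<close> is the principal right ideal of \<open>f\<close>.\<close>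

definition green_R :: "('a, 'b) monoid_scheme \<Rightarrow> ('a \<times> 'a) set" where
  "green_R G = {(f, g). f \<in> carrier G \<and> g \<in> carrier G \<and>
                        f <#\<^bsub>G\<^esub> carrier G = g <#\<^bsub>G\<^esub> carrier G}"

definition op_T :: "('a \<times> 'a \<Rightarrow> 'a) \<Rightarrow> 'a \<times> 'a \<Rightarrow> 'a \<times> 'a" where
  "op_T f = (\<lambda>(a, b). (f (a, b), f (b, a)))"

definition op_ker :: "'a set \<Rightarrow> ('a \<times> 'a \<Rightarrow> 'a) \<Rightarrow> (('a \<times> 'a) \<times> ('a \<times> 'a)) set" where
  "op_ker X f = {(p, q). p \<in> X \<times> X \<and> q \<in> X \<times> X \<and> op_T f p = op_T f q}"

lemma binop_monoid_monoid: "monoid (binop_monoid X)"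
proof (rule monoidI)
  fix f g assume "f \<in> carrier (binop_monoid X)" "g \<in> carrier (binop_monoid X)"
  then show "f \<otimes>\<^bsub>binop_monoid X\<^esub> g \<in> carrier (binop_monoid X)"
    by (auto simp: binop_monoid_def PiE_iff)
next
  show "\<one>\<^bsub>binop_monoid X\<^esub> \<in> carrier (binop_monoid X)"
    by (auto simp: binop_monoid_def)
next
  fix f g h
  assume "f \<in> carrier (binop_monoid X)" "g \<in> carrier (binop_monoid X)"
    "h \<in> carrier (binop_monoid X)"
  then show "f \<otimes>\<^bsub>binop_monoid X\<^esub> g \<otimes>\<^bsub>binop_monoid X\<^esub> h =
             f \<otimes>\<^bsub>binop_monoid X\<^esub> (g \<otimes>\<^bsub>binop_monoid X\<^esub> h)"
    by (auto simp: binop_monoid_def PiE_iff restrict_def fun_eq_iff)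
next
  fix f assume f: "f \<in> carrier (binop_monoid X)"
  then show "\<one>\<^bsub>binop_monoid X\<^esub> \<otimes>\<^bsub>binop_monoid X\<^esub> f = f"
    by (auto simp: binop_monoid_def PiE_iff extensional_def restrict_def fun_eq_iff)
  from f show "f \<otimes>\<^bsub>binop_monoid X\<^esub> \<one>\<^bsub>binop_monoid X\<^esub> = f"
    by (auto simp: binop_monoid_def PiE_iff extensional_def restrict_def fun_eq_iff)
qed

lemma equiv_op_ker: "equiv (X \<times> X) (op_ker X f)"
  by (intro equivI) (auto simp: op_ker_def refl_on_def sym_def trans_def)

end

theory Submission
  imports Defs
begin

text \<open>
  The product \<open>f \<triangleright> h\<close> is \<open>h \<circ> T\<^sub>f\<close>, so \<open>g\<close> lies in the right ideal of \<open>f\<close> iff \<open>g\<close> factors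
  through \<open>T\<^sub>f\<close>. As \<open>T\<^sub>f\<close> commutes with swapping coordinates, this happens iff \<open>\<pi>\<^sub>f \<subseteq> \<pi>\<^sub>g\<close>.
\<close>

text \<open>The unit puts \<open>b\<close> into its own right ideal, and by associativity the right
  ideal of \<open>a\<close> absorbs right multiplication. Comparing ideals thus becomes a question
  of solving \<open>b = a \<otimes> c\<close>.\<close>

lemma (in monoid) l_coset_carrier_subset_iff:
  assumes "a \<in> carrier G" "b \<in> carrier G"
  shows "b <# carrier G \<subseteq> a <# carrier G \<longleftrightarrow> b \<in> a <# carrier G"
proof
  have "b \<otimes> \<one> \<in> b <# carrier G"
    unfolding l_coset_def by blast
  then have "b \<in> b <# carrier G"
    using assms by simp
  then show "b \<in> a <# carrier G" if "b <# carrier G \<subseteq> a <# carrier G"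
    using that by blast
next
  assume "b \<in> a <# carrier G"
  then obtain c where c: "c \<in> carrier G" "b = a \<otimes> c"
    by (auto simp: l_coset_def)
  have "b \<otimes> d \<in> a <# carrier G" if "d \<in> carrier G" for d
    using that c assms by (auto simp: l_coset_def m_assoc)
  then show "b <# carrier G \<subseteq> a <# carrier G"
    by (auto simp: l_coset_def)
qed

lemma op_T_in_carrier:
  assumes "f \<in> carrier (binop_monoid X)" "p \<in> X \<times> X"
  shows "op_T f p \<in> X \<times> X"
  using assms by (auto simp: binop_monoid_def op_T_def)

lemma binop_mult_apply:
  "p \<in> X \<times> X \<Longrightarrow> (f \<otimes>\<^bsub>binop_monoid X\<^esub> h) p = h (op_T f p)"
  by (auto simp: binop_monoid_def op_T_def)

text \<open>\<open>op_T f (b, a)\<close> is the swap of \<open>op_T f (a, b)\<close>, so on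
  \<open>X \<times> X\<close> the map \<open>op_T\<close> of the product is \<open>op_T h\<close>
  after \<open>op_T f\<close>.\<close>

lemma op_ker_subset_mult: "op_ker X f \<subseteq> op_ker X (f \<otimes>\<^bsub>binop_monoid X\<^esub> h)"
  by (auto simp: op_ker_def op_T_def binop_mult_apply)

lemma op_ker_subset_imp_mult:
  assumes f: "f \<in> carrier (binop_monoid X)" and g: "g \<in> carrier (binop_monoid X)"
    and ker: "op_ker X f \<subseteq> op_ker X g"
  obtains h where "h \<in> carrier (binop_monoid X)" "g = f \<otimes>\<^bsub>binop_monoid X\<^esub> h"
proof
  \<comment> \<open>\<open>s\<close> is a section of \<open>op_T f\<close> over its image. Off the
    image any value in \<open>X \<times> X\<close> would do; the identity keeps \<open>h\<close> an
    operation on \<open>X\<close>.\<close>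
  define s where "s p = (if p \<in> op_T f ` (X \<times> X) then inv_into (X \<times> X) (op_T f) p else p)" for p
  define h where "h = (\<lambda>p \<in> X \<times> X. g (s p))"
  have s: "s p \<in> X \<times> X" if "p \<in> X \<times> X" for p
    using that inv_into_into[of p "op_T f" "X \<times> X"] by (simp add: s_def)
  moreover have "g q \<in> X" if "q \<in> X \<times> X" for q
    using g that by (auto simp: binop_monoid_def)
  ultimately show "h \<in> carrier (binop_monoid X)"
    unfolding h_def binop_monoid_def partial_object.simps by (intro restrict_PiE[THEN iffD2] Pi_I) blast
  show "g = f \<otimes>\<^bsub>binop_monoid X\<^esub> h"
  proof (rule extensionalityI[of _ "X \<times> X"])
    show "g \<in> extensional (X \<times> X)"
      using g by (simp add: binop_monoid_def PiE_iff)
    show "f \<otimes>\<^bsub>binop_monoid X\<^esub> h \<in> extensional (X \<times> X)"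
      by (simp add: binop_monoid_def)
    fix p assume p: "p \<in> X \<times> X"
    note Tp = op_T_in_carrier[OF f p]
    \<comment> \<open>The chosen preimage of \<open>op_T f p\<close> may differ from
      \<open>p\<close>, but it is kernel-equivalent to \<open>p\<close> under \<open>f\<close>,
      hence by \<open>ker\<close> under \<open>g\<close>.\<close>
    have "op_T f (s (op_T f p)) = op_T f p"
      using p by (simp add: s_def f_inv_into_f)
    then have "(s (op_T f p), p) \<in> op_ker X f"
      using s[OF Tp] p by (simp add: op_ker_def)
    with ker have "(s (op_T f p), p) \<in> op_ker X g"
      by (rule subsetD)
    then have "op_T g (s (op_T f p)) = op_T g p"
      by (simp add: op_ker_def)
    \<comment> \<open>First coordinates of the two \<open>op_T g\<close> values.\<close>
    then have "g (s (op_T f p)) = g p"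
      by (simp add: op_T_def split: prod.splits)
    then show "g p = (f \<otimes>\<^bsub>binop_monoid X\<^esub> h) p"
      using p Tp by (simp add: binop_mult_apply h_def)
  qed
qed

lemma mem_right_ideal_iff_op_ker_subset:
  assumes "f \<in> carrier (binop_monoid X)" "g \<in> carrier (binop_monoid X)"
  shows "g \<in> f <#\<^bsub>binop_monoid X\<^esub> carrier (binop_monoid X) \<longleftrightarrow> op_ker X f \<subseteq> op_ker X g"
proof
  assume "g \<in> f <#\<^bsub>binop_monoid X\<^esub> carrier (binop_monoid X)"
  then obtain h where "g = f \<otimes>\<^bsub>binop_monoid X\<^esub> h"
    by (auto simp: l_coset_def)
  then show "op_ker X f \<subseteq> op_ker X g"
    using op_ker_subset_mult by metis
next
  assume "op_ker X f \<subseteq> op_ker X g"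
  then obtain h where "h \<in> carrier (binop_monoid X)" "g = f \<otimes>\<^bsub>binop_monoid X\<^esub> h"
    using op_ker_subset_imp_mult assms by blast
  then show "g \<in> f <#\<^bsub>binop_monoid X\<^esub> carrier (binop_monoid X)"
    by (auto simp: l_coset_def)
qed

theorem corollary13:
  fixes X :: "'a set" and f g :: "'a \<times> 'a \<Rightarrow> 'a"
  assumes "finite X"
    and "f \<in> carrier (binop_monoid X)"
    and "g \<in> carrier (binop_monoid X)"
  shows "(f, g) \<in> green_R (binop_monoid X) \<longleftrightarrow> op_ker X f = op_ker X g"
proof -
  let ?M = "binop_monoid X"
  \<comment> \<open>A smaller right ideal corresponds to a larger kernel. Applied to
    \<open>f\<close> and \<open>g\<close> in both orders, this turns equality of ideals into
    equality of kernels.\<close>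
  have "v <#\<^bsub>?M\<^esub> carrier ?M \<subseteq> u <#\<^bsub>?M\<^esub> carrier ?M \<longleftrightarrow> op_ker X u \<subseteq> op_ker X v"
    if "u \<in> carrier ?M" "v \<in> carrier ?M" for u v
    using that mem_right_ideal_iff_op_ker_subset
      monoid.l_coset_carrier_subset_iff[OF binop_monoid_monoid] by metis
  with assms(2,3) show ?thesis
    unfolding green_R_def by blast
qed

end
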